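(* Let $I,J\subseteq\mathbb R$ be open intervals, let $a:I\to\mathbb R$ and $b:J\to\mathbb R$ be arbitrary continuous functions and let $z$ be a nonzero real number. Put $$\Xi(x):=\exp\left(-\int^x a(\xi)\,\mathrm d\xi\right),\qquad \gamma(t):=\int^t b(\tau)\,\mathrm d\tau .$$ The general solution of the first-order system of deformed generalized Buchdahl equations ($x\in I$, $y\neq0$, $t\in J$) $$\begin{aligned} \frac{\mathrm dx}{\mathrm dt}&=y+b(t)\left(\frac{\exp\bigl(zy\,\Xi(x)\bigr)-1-zy\,\Xi(x)}{zy\,\Xi^2(x)}\right)\exp\bigl(-zy\,\Xi(x)\bigr)\int^x\Xi(\xi)\,\mathrm d\xi,\\ \frac{\mathrm dy}{\mathrm dt}&=a(x)y^2+b(t)\exp\bigl(-zy\,\Xi(x)\bigr)\\ &\quad\times\left(\frac{\exp\bigl(zy\,\Xi(x)\bigr)-1}{z\,\Xi(x)}+\frac{\exp\bigl(zy\,\Xi(x)\bigr)-1-zy\,\Xi(x)}{z\,\Xi^2(x)}\,a(x)\int^x\Xi(\xi)\,\mathrm d\xi\right) \end{aligned}$$ is given by $$\begin{aligned} \int^x\Xi(\xi)\,\mathrm d\xi&=\frac{\ln\bigl(1-zc_1\mathrm e^{\gamma(t)}\bigr)}{z}\left(\mathrm e^{-\gamma(t)}-zc_1\right)\left(c_2+\int^t\frac{1}{\mathrm e^{-\gamma(\tau)}-zc_1}\,\mathrm d\tau\right),\\ y(t)&=\frac{\ln\bigl(1-zc_1\mathrm e^{\gamma(t)}\bigr)}{z\,\Xi(x)},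 \end{aligned}$$ where $c_1$ and $c_2$ are the two integration constants determined by the initial conditions. That is, for functions $x:J'\to I$ and $y:J'\to\mathbb R\setminus\{0\}$ on an open interval $J'\subseteq J$, the pair $(x(t),y(t))$ is a solution of the system on $J'$ if and only if there are real constants $c_1,c_2$ with $1-zc_1\mathrm e^{\gamma(t)}>0$ on $J'$ such that the two displayed formulas hold for all $t\in J'$.
   Context: Indefinite integrals $\int^x(\cdot)\,\mathrm d\xi$ and $\int^t(\cdot)\,\mathrm d\tau$ denote antiderivatives of the integrand, chosen once and for all (the same choice wherever the same integral appears; the antiderivative of $1/(\mathrm e^{-\gamma}-zc_1)$ is taken on the interval $J'$ where the solution is defined); thus $\Xi>0$, $\Xi'=-a\,\Xi$, $\gamma'=b$. The variable $y$ is assumed nonzero throughout. *)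

theory Defs
  imports "HOL-Analysis.Analysis"
begin

text \<open>
  An indefinite integral stands for an arbitrary but fixed antiderivative; the set
  \<open>S\<close> is always open below, so the two-sided derivative is the right notion.
\<close>

definition antiderivative_on :: "(real \<Rightarrow> real) \<Rightarrow> (real \<Rightarrow> real) \<Rightarrow> real set \<Rightarrow> bool" where
  "antiderivative_on F f S \<longleftrightarrow> (\<forall>s\<in>S. (F has_real_derivative f s) (at s))"

text \<open>
  In the right-hand sides \<open>\<Xi>\<close> is the function $\exp(-\int^x a)$ and \<open>Q\<close> is the
  antiderivative $\int^x \Xi$; both are parameters because they depend on the choice of
  the indefinite integrals.
\<close>

definition buchdahl_rhs_x ::
    "real \<Rightarrow> (real \<Rightarrow> real) \<Rightarrow> (real \<Rightarrow> real) \<Rightarrow> (real \<Rightarrow> real) \<Rightarrow> real \<Rightarrow> real \<Rightarrow> real \<Rightarrow> real" where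
  "buchdahl_rhs_x z b \<Xi> Q t x y =
     y + b t * ((exp (z * y * \<Xi> x) - 1 - z * y * \<Xi> x) / (z * y * (\<Xi> x)\<^sup>2))
           * exp (- (z * y * \<Xi> x)) * Q x"

definition buchdahl_rhs_y ::
    "real \<Rightarrow> (real \<Rightarrow> real) \<Rightarrow> (real \<Rightarrow> real) \<Rightarrow> (real \<Rightarrow> real) \<Rightarrow> (real \<Rightarrow> real)
      \<Rightarrow> real \<Rightarrow> real \<Rightarrow> real \<Rightarrow> real" where
  "buchdahl_rhs_y z a b \<Xi> Q t x y =
     a x * y\<^sup>2 + b t * exp (- (z * y * \<Xi> x))
       * ((exp (z * y * \<Xi> x) - 1) / (z * \<Xi> x)
          + (exp (z * y * \<Xi> x) - 1 - z * y * \<Xi> x) / (z * (\<Xi> x)\<^sup>2) * a x * Q x)"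

definition buchdahl_solution_on ::
    "real \<Rightarrow> (real \<Rightarrow> real) \<Rightarrow> (real \<Rightarrow> real) \<Rightarrow> (real \<Rightarrow> real) \<Rightarrow> (real \<Rightarrow> real) \<Rightarrow> real set
      \<Rightarrow> (real \<Rightarrow> real) \<Rightarrow> (real \<Rightarrow> real) \<Rightarrow> bool" where
  "buchdahl_solution_on z a b \<Xi> Q J' x y \<longleftrightarrow>
     (\<forall>t\<in>J'. (x has_real_derivative buchdahl_rhs_x z b \<Xi> Q t (x t) (y t)) (at t)
           \<and> (y has_real_derivative buchdahl_rhs_y z a b \<Xi> Q t (x t) (y t)) (at t))"

end

theory Submission
  imports Defs
begin

text \<open>
  In the variables $q = Q(x)$ and $p = y\,\Xi(x)$ the coefficient $a$ disappears and the system
  becomes $p' = b\,(1 - e^{-zp})/z$, $q' = p + b\,\frac{e^{zp} - 1 - zp}{zp}\,e^{-zp} q$.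
  The first equation is linear in $u = e^{zp}$, namely $u' = b\,(u - 1)$, so that
  $u = 1 - z c_1 e^{\gamma}$. The second one is linear in $q$, and with
  $w = e^{-\gamma} - z c_1 = e^{-\gamma} u$ the product $pw$ solves its homogeneous part; hence
  $(q/(pw))' = 1/w$. The change of variables can be undone because $Q' = \Xi > 0$ makes
  $Q$ a diffeomorphism onto its image.
\<close>

definition reduced_rhs_p :: "real \<Rightarrow> (real \<Rightarrow> real) \<Rightarrow> real \<Rightarrow> real \<Rightarrow> real" where
  "reduced_rhs_p z b t p = b t * (1 - exp (- (z * p))) / z"

definition reduced_rhs_q :: "real \<Rightarrow> (real \<Rightarrow> real) \<Rightarrow> real \<Rightarrow> real \<Rightarrow> real \<Rightarrow> real" where
  "reduced_rhs_q z b t p q = p + b t * (exp (z * p) - 1 - z * p) / (z * p) * exp (- (z * p)) * q"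

lemma inj_on_of_pos_deriv:
  fixes Q \<Xi> :: "real \<Rightarrow> real"
  assumes "is_interval I" and "antiderivative_on Q \<Xi> I" and "\<And>s. s \<in> I \<Longrightarrow> \<Xi> s > 0"
  shows "inj_on Q I"
proof -
  have less: "Q r < Q s" if "r \<in> I" "s \<in> I" "r < s" for r s
  proof (rule DERIV_pos_imp_increasing[OF \<open>r < s\<close>])
    fix v assume "r \<le> v" "v \<le> s"
    then have "v \<in> I"
      using assms(1) that unfolding is_interval_1 by blast
    then show "\<exists>d. (Q has_real_derivative d) (at v) \<and> 0 < d"
      using assms(2,3) unfolding antiderivative_on_def by blast
  qed
  show ?thesis
    by (rule linorder_inj_onI') (use less in force)
qed

text \<open>This undoes the substitution q = Q(x): a solution formula only controls
  \<open>Q (x t)\<close>, so differentiability of \<open>x\<close> has to be deduced. Writing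
  \<open>x\<close> as g(Q(x)), with g the inverse of \<open>Q\<close>, gives it without assuming
  even continuity of \<open>x\<close>.\<close>

lemma has_real_derivative_of_composition:
  fixes Q \<Xi> x :: "real \<Rightarrow> real"
  assumes "open I" and "is_interval I" and Q: "antiderivative_on Q \<Xi> I"
    and pos: "\<And>s. s \<in> I \<Longrightarrow> \<Xi> s > 0"
    and "open T" and "t \<in> T" and x: "\<And>s. s \<in> T \<Longrightarrow> x s \<in> I"
    and D: "((\<lambda>s. Q (x s)) has_real_derivative D) (at t)"
  shows "(x has_real_derivative D / \<Xi> (x t)) (at t)"
proof -
  define g where "g = inv_into I Q"
  have gQ: "g (Q s) = s" if "s \<in> I" for s
    unfolding g_def using inj_on_of_pos_deriv[OF assms(2) Q pos] that by simp
  have QD: "(Q has_real_derivative \<Xi> s) (at s)" if "s \<in> I" for s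
    using Q that unfolding antiderivative_on_def by blast
  have cont: "continuous_on I Q"
    using QD by (meson DERIV_isCont continuous_at_imp_continuous_on)
  have "(g has_real_derivative inverse (\<Xi> (x t))) (at (Q (x t)))"
    unfolding has_field_derivative_def
  \<comment> \<open>This form of the inverse function theorem asks for continuity of
    \<open>Q\<close> on the open set \<open>I\<close>, a left inverse there, and an invertible
    derivative at the single point \<open>x t\<close>; continuity of \<Xi> is not involved.\<close>
  proof (rule has_derivative_inverse_strong[OF \<open>open I\<close> x[OF \<open>t \<in> T\<close>] cont gQ])
    show "(Q has_derivative (*) (\<Xi> (x t))) (at (x t))"
      using QD[OF x[OF \<open>t \<in> T\<close>]] by (simp add: has_field_derivative_def)
    show "(*) (\<Xi> (x t)) \<circ> (*) (inverse (\<Xi> (x t))) = id"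
      using pos[OF x[OF \<open>t \<in> T\<close>]] by (auto simp: fun_eq_iff)
  qed
  from DERIV_chain2[OF this D] have "((\<lambda>s. g (Q (x s))) has_real_derivative D / \<Xi> (x t)) (at t)"
    by (simp add: field_simps)
  then show ?thesis
    by (rule has_field_derivative_transform_within_open[OF _ \<open>open T\<close> \<open>t \<in> T\<close>]) (use gQ x in simp)
qed

text \<open>The pointwise algebra behind the change of variables. Since \<Xi>' = -a \<Xi>, the chain
  rule gives q' = \<Xi> x' and p' = \<Xi> y' - a \<Xi> y x'; solving the latter for y' yields the
  second identity.\<close>

lemma buchdahl_rhs_reduced:
  fixes \<Xi> Q a b :: "real \<Rightarrow> real"
  assumes "\<Xi> x > 0" "y \<noteq> 0" "z \<noteq> 0"
  shows "\<Xi> x * buchdahl_rhs_x z b \<Xi> Q t x y = reduced_rhs_q z b t (y * \<Xi> x) (Q x)"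
    and "buchdahl_rhs_y z a b \<Xi> Q t x y =
      reduced_rhs_p z b t (y * \<Xi> x) / \<Xi> x + a x * y * buchdahl_rhs_x z b \<Xi> Q t x y"
proof -
  \<comment> \<open>With this abbreviation both exponentials are rational in \<open>E\<close>, so
    each identity becomes one between rational functions.\<close>
  define E where "E = exp (- (z * y * \<Xi> x))"
  have E: "exp (z * y * \<Xi> x) = 1 / E" "E \<noteq> 0"
    by (auto simp: E_def exp_minus field_simps)
  have e: "z * (y * \<Xi> x) = z * y * \<Xi> x" by simp
  show "\<Xi> x * buchdahl_rhs_x z b \<Xi> Q t x y = reduced_rhs_q z b t (y * \<Xi> x) (Q x)"
    using assms E(2) unfolding buchdahl_rhs_x_def reduced_rhs_q_def e E E_def[symmetric]
    by (simp add: divide_simps power2_eq_square)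
  show "buchdahl_rhs_y z a b \<Xi> Q t x y =
      reduced_rhs_p z b t (y * \<Xi> x) / \<Xi> x + a x * y * buchdahl_rhs_x z b \<Xi> Q t x y"
    using assms E(2)
    unfolding buchdahl_rhs_x_def buchdahl_rhs_y_def reduced_rhs_p_def e E E_def[symmetric]
    by (simp add: divide_simps power2_eq_square) (simp add: algebra_simps)
qed

text \<open>The order matters in the converse direction: x' is recovered first from q, and only then
  can y = p exp(A(x)) be differentiated, because the chain rule for A(x) needs x'.\<close>

lemma buchdahl_solution_iff_reduced:
  fixes I T :: "real set" and a b A \<Xi> Q x y :: "real \<Rightarrow> real"
  assumes "open I" and "is_interval I" and "open T" and "z \<noteq> 0"
    and A: "antiderivative_on A a I" and \<Xi>: "\<And>s. \<Xi> s = exp (- A s)"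
    and Q: "antiderivative_on Q \<Xi> I"
    and xI: "\<And>t. t \<in> T \<Longrightarrow> x t \<in> I" and y0: "\<And>t. t \<in> T \<Longrightarrow> y t \<noteq> 0"
  shows "buchdahl_solution_on z a b \<Xi> Q T x y \<longleftrightarrow>
    (\<forall>t\<in>T. ((\<lambda>t. y t * \<Xi> (x t)) has_real_derivative
                reduced_rhs_p z b t (y t * \<Xi> (x t))) (at t) \<and>
            ((\<lambda>t. Q (x t)) has_real_derivative
                reduced_rhs_q z b t (y t * \<Xi> (x t)) (Q (x t))) (at t))"
  unfolding buchdahl_solution_on_def
proof (rule ball_cong[OF refl], rule iffI)
  fix t assume t: "t \<in> T"
  let ?X = "buchdahl_rhs_x z b \<Xi> Q t (x t) (y t)"
    and ?Y = "buchdahl_rhs_y z a b \<Xi> Q t (x t) (y t)"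
    and ?P = "reduced_rhs_p z b t (y t * \<Xi> (x t))"
    and ?R = "reduced_rhs_q z b t (y t * \<Xi> (x t)) (Q (x t))"
  have pos: "\<Xi> s > 0" for s by (simp add: \<Xi>)
  have eqX: "\<Xi> (x t) * ?X = ?R" and eqY: "?Y = ?P / \<Xi> (x t) + a (x t) * y t * ?X"
    using buchdahl_rhs_reduced[where \<Xi> = \<Xi> and x = "x t", OF pos y0[OF t] \<open>z \<noteq> 0\<close>] by auto
  have AD: "(A has_real_derivative a (x t)) (at (x t))"
    and QD: "(Q has_real_derivative \<Xi> (x t)) (at (x t))"
    using A Q xI[OF t] unfolding antiderivative_on_def by auto
  {
    assume "(x has_real_derivative ?X) (at t) \<and> (y has_real_derivative ?Y) (at t)"
    then have X: "(x has_real_derivative ?X) (at t)" and Y: "(y has_real_derivative ?Y) (at t)"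
      by auto
    \<comment> \<open>\<Xi> is written out as an exponential so that its derivative comes from that
      of \<open>A\<close>. The terms in a x' then cancel by \<open>eqY\<close>.\<close>
    have "((\<lambda>t. y t * exp (- A (x t))) has_real_derivative
        ?Y * exp (- A (x t)) + (exp (- A (x t)) * - (a (x t) * ?X)) * y t) (at t)"
      by (intro DERIV_mult Y DERIV_fun_exp DERIV_minus DERIV_chain2[OF AD X])
    moreover have "?Y * exp (- A (x t)) + (exp (- A (x t)) * - (a (x t) * ?X)) * y t = ?P"
      unfolding \<Xi>[symmetric] eqY using pos[of "x t"] by (simp add: field_simps)
    ultimately have "((\<lambda>t. y t * \<Xi> (x t)) has_real_derivative ?P) (at t)"
      by (simp add: \<Xi>)
    moreover have "((\<lambda>t. Q (x t)) has_real_derivative ?R) (at t)"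
      using DERIV_chain2[OF QD X] eqX by simp
    ultimately show "((\<lambda>t. y t * \<Xi> (x t)) has_real_derivative ?P) (at t) \<and>
        ((\<lambda>t. Q (x t)) has_real_derivative ?R) (at t)" by blast
  next
    assume "((\<lambda>t. y t * \<Xi> (x t)) has_real_derivative ?P) (at t) \<and>
        ((\<lambda>t. Q (x t)) has_real_derivative ?R) (at t)"
    then have P: "((\<lambda>t. y t * \<Xi> (x t)) has_real_derivative ?P) (at t)"
      and R: "((\<lambda>t. Q (x t)) has_real_derivative ?R) (at t)" by auto
    have "?R / \<Xi> (x t) = ?X"
      using eqX pos[of "x t"] by (simp add: field_simps)
    then have X: "(x has_real_derivative ?X) (at t)"
      using has_real_derivative_of_composition[OF assms(1,2) Q pos \<open>open T\<close> t xI R] by simp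
    have "((\<lambda>t. y t * \<Xi> (x t) * exp (A (x t))) has_real_derivative
        ?P * exp (A (x t)) + (exp (A (x t)) * (a (x t) * ?X)) * (y t * \<Xi> (x t))) (at t)"
      by (intro DERIV_mult P DERIV_fun_exp DERIV_chain2[OF AD X])
    moreover have "?P * exp (A (x t)) + (exp (A (x t)) * (a (x t) * ?X)) * (y t * \<Xi> (x t)) = ?Y"
      unfolding eqY by (simp add: \<Xi> exp_minus field_simps)
    moreover have "(\<lambda>t. y t * \<Xi> (x t) * exp (A (x t))) = y"
      by (simp add: \<Xi> exp_minus field_simps)
    ultimately have "(y has_real_derivative ?Y) (at t)" by simp
    with X show "(x has_real_derivative ?X) (at t) \<and> (y has_real_derivative ?Y) (at t)" by blast
  }
qed

lemma interval_deriv_zero_constant: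
  fixes f :: "real \<Rightarrow> real"
  assumes "is_interval T" and "\<And>t. t \<in> T \<Longrightarrow> (f has_real_derivative 0) (at t)"
  shows "\<exists>c. \<forall>t\<in>T. f t = c"
proof -
  have "convex T" using assms(1) by (simp add: is_interval_convex_1)
  from has_field_derivative_zero_constant[OF this has_field_derivative_at_within[OF assms(2)]]
  show ?thesis by blast
qed

text \<open>Solving u = exp(zp) = 1 - z c exp(\<gamma>) for c produces a first integral of the
  equation. It is constant because \<open>T\<close> is an interval, and its value is the integration
  constant.\<close>

lemma reduced_p_solution_iff:
  fixes T :: "real set" and b \<gamma> p :: "real \<Rightarrow> real"
  assumes "open T" and "is_interval T" and "z \<noteq> 0" and \<gamma>: "antiderivative_on \<gamma> b T"
  shows "(\<forall>t\<in>T. (p has_real_derivative reduced_rhs_p z b t (p t)) (at t)) \<longleftrightarrow>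
    (\<exists>c. \<forall>t\<in>T. 1 - z * c * exp (\<gamma> t) > 0 \<and> p t = ln (1 - z * c * exp (\<gamma> t)) / z)"
proof
  have \<gamma>D: "(\<gamma> has_real_derivative b t) (at t)" if "t \<in> T" for t
    using \<gamma> that unfolding antiderivative_on_def by blast
  {
    assume p: "\<forall>t\<in>T. (p has_real_derivative reduced_rhs_p z b t (p t)) (at t)"
    have "((\<lambda>t. (1 - exp (z * p t)) * exp (- \<gamma> t) / z) has_real_derivative 0) (at t)"
      if t: "t \<in> T" for t
      by (rule derivative_eq_intros \<gamma>D[OF t] p[rule_format, OF t] refl \<open>z \<noteq> 0\<close>)+
        (use \<open>z \<noteq> 0\<close> in \<open>simp add: reduced_rhs_p_def exp_minus field_simps\<close>)
    then obtain c where c: "\<forall>t\<in>T. (1 - exp (z * p t)) * exp (- \<gamma> t) / z = c"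
      using interval_deriv_zero_constant[OF \<open>is_interval T\<close>] by blast
    \<comment> \<open>The positivity condition on c is automatic here, since the expression is an
      exponential.\<close>
    have "1 - z * c * exp (\<gamma> t) = exp (z * p t)" if "t \<in> T" for t
      using c[rule_format, OF that, symmetric] \<open>z \<noteq> 0\<close> by (simp add: exp_minus field_simps)
    then show "\<exists>c. \<forall>t\<in>T. 1 - z * c * exp (\<gamma> t) > 0 \<and> p t = ln (1 - z * c * exp (\<gamma> t)) / z"
      using \<open>z \<noteq> 0\<close> by (intro exI[of _ c]) auto
  next
    assume "\<exists>c. \<forall>t\<in>T. 1 - z * c * exp (\<gamma> t) > 0 \<and> p t = ln (1 - z * c * exp (\<gamma> t)) / z"
    then obtain c where pos: "\<And>t. t \<in> T \<Longrightarrow> 1 - z * c * exp (\<gamma> t) > 0"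
      and p: "\<And>t. t \<in> T \<Longrightarrow> p t = ln (1 - z * c * exp (\<gamma> t)) / z" by blast
    show "\<forall>t\<in>T. (p has_real_derivative reduced_rhs_p z b t (p t)) (at t)"
    proof
      fix t assume t: "t \<in> T"
      have "exp (- (z * p t)) = 1 / (1 - z * c * exp (\<gamma> t))"
        using pos[OF t] p[OF t] \<open>z \<noteq> 0\<close> by (simp add: exp_minus field_simps)
      then have "((\<lambda>t. ln (1 - z * c * exp (\<gamma> t)) / z) has_real_derivative
          reduced_rhs_p z b t (p t)) (at t)"
        unfolding reduced_rhs_p_def
        by (auto intro!: derivative_eq_intros \<gamma>D[OF t] pos[OF t] \<open>z \<noteq> 0\<close>)
          (use pos[OF t] \<open>z \<noteq> 0\<close> in \<open>simp add: field_simps\<close>)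
      then show "(p has_real_derivative reduced_rhs_p z b t (p t)) (at t)"
        by (rule has_field_derivative_transform_within_open[OF _ \<open>open T\<close> t]) (simp add: p)
    qed
  }
qed

text \<open>Variation of constants for a fixed c: a nowhere vanishing solution \<open>h\<close> of
  the homogeneous equation is divided out. The condition p \<noteq> 0 both gives h \<noteq> 0 and
  allows the denominator zp to be cleared.\<close>

lemma reduced_q_solution_iff:
  fixes T :: "real set" and b \<gamma> p q L :: "real \<Rightarrow> real"
  assumes "open T" and "is_interval T" and "z \<noteq> 0" and \<gamma>: "antiderivative_on \<gamma> b T"
    and L: "antiderivative_on L (\<lambda>t. 1 / (exp (- \<gamma> t) - z * c)) T"
    and pos: "\<And>t. t \<in> T \<Longrightarrow> 1 - z * c * exp (\<gamma> t) > 0"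
    and p: "\<And>t. t \<in> T \<Longrightarrow> p t = ln (1 - z * c * exp (\<gamma> t)) / z"
    and p0: "\<And>t. t \<in> T \<Longrightarrow> p t \<noteq> 0"
  shows "(\<forall>t\<in>T. (q has_real_derivative reduced_rhs_q z b t (p t) (q t)) (at t)) \<longleftrightarrow>
    (\<exists>c\<^sub>2. \<forall>t\<in>T. q t = p t * (exp (- \<gamma> t) - z * c) * (c\<^sub>2 + L t))"
proof -
  define h where "h t = p t * (exp (- \<gamma> t) - z * c)" for t
  have \<gamma>D: "(\<gamma> has_real_derivative b t) (at t)"
    and LD: "(L has_real_derivative 1 / (exp (- \<gamma> t) - z * c)) (at t)" if "t \<in> T" for t
    using \<gamma> L that unfolding antiderivative_on_def by auto
  have pD: "(p has_real_derivative reduced_rhs_p z b t (p t)) (at t)" if "t \<in> T" for t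
    using reduced_p_solution_iff[OF assms(1-4)] pos p that by blast
  have u: "exp (z * p t) = 1 - z * c * exp (\<gamma> t)" if "t \<in> T" for t
    using pos[OF that] p[OF that] \<open>z \<noteq> 0\<close> by simp
  \<comment> \<open>As a product of exponentials this factor cannot vanish, and in this shape it
    cancels against the exp(-zp) in \<open>k\<close>.\<close>
  have w: "exp (- \<gamma> t) - z * c = exp (- \<gamma> t) * exp (z * p t)" if "t \<in> T" for t
    by (simp add: u[OF that] exp_minus right_diff_distrib)
  have h0: "h t \<noteq> 0" if "t \<in> T" for t
    using w[OF that] p0[OF that] by (simp add: h_def)
  \<comment> \<open>The coefficient of q in the linear equation, whose inhomogeneous term is
    p.\<close>
  define k where "k t = b t * (exp (z * p t) - 1 - z * p t) / (z * p t) * exp (- (z * p t))" for t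
  have hD: "(h has_real_derivative k t * h t) (at t)" if t: "t \<in> T" for t
  proof -
    have "(h has_real_derivative
        reduced_rhs_p z b t (p t) * (exp (- \<gamma> t) - z * c) + - b t * exp (- \<gamma> t) * p t) (at t)"
      unfolding h_def
      by (rule derivative_eq_intros \<gamma>D[OF t] pD[OF t] refl)+ simp
    moreover have "reduced_rhs_p z b t (p t) * (exp (- \<gamma> t) - z * c) + - b t * exp (- \<gamma> t) * p t
        = k t * h t"
      unfolding h_def k_def reduced_rhs_p_def w[OF t]
      using p0[OF t] \<open>z \<noteq> 0\<close> by (simp add: exp_minus field_simps)
    ultimately show ?thesis by simp
  qed
  have rhs: "reduced_rhs_q z b t (p t) r = p t + k t * r" for t r
    by (simp add: reduced_rhs_q_def k_def)
  \<comment> \<open>Rewriting the integrand as p/h matches it with (q/h)', which equals p/h when q'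
    = p + kq and h' = kh.\<close>
  have LD': "(L has_real_derivative p t / h t) (at t)" if "t \<in> T" for t
    using LD[OF that] p0[OF that] by (simp add: h_def)
  show ?thesis
    unfolding rhs h_def[symmetric]
  proof
    assume q: "\<forall>t\<in>T. (q has_real_derivative p t + k t * q t) (at t)"
    have "((\<lambda>t. q t / h t - L t) has_real_derivative 0) (at t)" if t: "t \<in> T" for t
      by (rule derivative_eq_intros hD[OF t] q[rule_format, OF t] LD'[OF t] refl h0[OF t])+
        (use h0[OF t] in \<open>simp add: field_simps\<close>)
    then obtain c\<^sub>2 where "\<forall>t\<in>T. q t / h t - L t = c\<^sub>2"
      using interval_deriv_zero_constant[OF \<open>is_interval T\<close>] by blast
    then show "\<exists>c\<^sub>2. \<forall>t\<in>T. q t = h t * (c\<^sub>2 + L t)"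
      using h0 by (intro exI[of _ c\<^sub>2]) (auto simp: field_simps)
  next
    assume "\<exists>c\<^sub>2. \<forall>t\<in>T. q t = h t * (c\<^sub>2 + L t)"
    then obtain c\<^sub>2 where q: "\<And>t. t \<in> T \<Longrightarrow> q t = h t * (c\<^sub>2 + L t)" by blast
    show "\<forall>t\<in>T. (q has_real_derivative p t + k t * q t) (at t)"
    proof
      fix t assume t: "t \<in> T"
      have "((\<lambda>t. h t * (c\<^sub>2 + L t)) has_real_derivative p t + k t * q t) (at t)"
        by (rule derivative_eq_intros hD[OF t] LD'[OF t] refl)+
          (use h0[OF t] q[OF t] in \<open>simp add: algebra_simps\<close>)
      then show "(q has_real_derivative p t + k t * q t) (at t)"
        by (rule has_field_derivative_transform_within_open[OF _ \<open>open T\<close> t]) (simp add: q)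
    qed
  qed
qed

text \<open>\<open>L\<close> is a family indexed by c because the integrand of the second quadrature
  contains the first integration constant; the choice is thus made before any solution is given.
  Where 1 - z c exp(\<gamma>) > 0, the denominator exp(-\<gamma>) - z c is positive too.\<close>

theorem proposition4p2:
  fixes I J J' :: "real set" and a b :: "real \<Rightarrow> real" and z :: real
    and A \<Xi> Q \<gamma> :: "real \<Rightarrow> real" and L :: "real \<Rightarrow> real \<Rightarrow> real"
    and x y :: "real \<Rightarrow> real"
  assumes "open I" and "is_interval I" and "open J" and "is_interval J"
    and "continuous_on I a" and "continuous_on J b" and "z \<noteq> 0"
    and "antiderivative_on A a I"
    and "\<And>s. \<Xi> s = exp (- A s)"
    and "antiderivative_on Q \<Xi> I"
    and "antiderivative_on \<gamma> b J"
    and "open J'" and "is_interval J'" and "J' \<subseteq> J"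
    and "\<And>c. (\<forall>t\<in>J'. 1 - z * c * exp (\<gamma> t) > 0) \<Longrightarrow>
           antiderivative_on (L c) (\<lambda>t. 1 / (exp (- \<gamma> t) - z * c)) J'"
    and "\<And>t. t \<in> J' \<Longrightarrow> x t \<in> I"
    and "\<And>t. t \<in> J' \<Longrightarrow> y t \<noteq> 0"
  shows "buchdahl_solution_on z a b \<Xi> Q J' x y \<longleftrightarrow>
    (\<exists>c\<^sub>1 c\<^sub>2. (\<forall>t\<in>J'. 1 - z * c\<^sub>1 * exp (\<gamma> t) > 0) \<and>
       (\<forall>t\<in>J'.
          Q (x t) = ln (1 - z * c\<^sub>1 * exp (\<gamma> t)) / z * (exp (- \<gamma> t) - z * c\<^sub>1) * (c\<^sub>2 + L c\<^sub>1 t) \<and>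
          y t = ln (1 - z * c\<^sub>1 * exp (\<gamma> t)) / (z * \<Xi> (x t))))"
proof -
  have \<Xi>pos: "\<Xi> s > 0" for s by (simp add: assms(9))
  define p where "p t = y t * \<Xi> (x t)" for t
  define q where "q t = Q (x t)" for t
  define ell where "ell c t = ln (1 - z * c * exp (\<gamma> t)) / z" for c t
  have p0: "p t \<noteq> 0" if "t \<in> J'" for t
    using assms(17)[OF that] \<Xi>pos[of "x t"] by (simp add: p_def)
  have \<gamma>: "antiderivative_on \<gamma> b J'"
    using assms(11,14) by (auto simp: antiderivative_on_def)
  have yp: "y t = ln (1 - z * c * exp (\<gamma> t)) / (z * \<Xi> (x t)) \<longleftrightarrow> p t = ell c t" for c t
    using \<Xi>pos[of "x t"] assms(7) by (auto simp: p_def ell_def field_simps)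
  have "buchdahl_solution_on z a b \<Xi> Q J' x y \<longleftrightarrow>
      (\<forall>t\<in>J'. (p has_real_derivative reduced_rhs_p z b t (p t)) (at t)) \<and>
      (\<forall>t\<in>J'. (q has_real_derivative reduced_rhs_q z b t (p t) (q t)) (at t))"
    using buchdahl_solution_iff_reduced[where x = x and y = y, OF assms(1,2,12,7-10,16,17)]
    unfolding p_def[symmetric] q_def[symmetric] by blast
  also have "\<dots> \<longleftrightarrow> (\<exists>c. (\<forall>t\<in>J'. 1 - z * c * exp (\<gamma> t) > 0 \<and> p t = ell c t) \<and>
      (\<forall>t\<in>J'. (q has_real_derivative reduced_rhs_q z b t (p t) (q t)) (at t)))"
    unfolding reduced_p_solution_iff[OF assms(12,13,7) \<gamma>] ell_def by blast
  \<comment> \<open>The equation for q is solved under the quantifier, where c is already fixed, so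
    that \<open>L c\<close> is the antiderivative to use.\<close>
  also have "\<dots> \<longleftrightarrow> (\<exists>c. (\<forall>t\<in>J'. 1 - z * c * exp (\<gamma> t) > 0 \<and> p t = ell c t) \<and>
      (\<exists>c\<^sub>2. \<forall>t\<in>J'. q t = p t * (exp (- \<gamma> t) - z * c) * (c\<^sub>2 + L c t)))"
    by (intro ex_cong1 conj_cong refl reduced_q_solution_iff[OF assms(12,13,7) \<gamma>])
      (auto simp: ell_def p0 intro!: assms(15))
  \<comment> \<open>The factor p is replaced by its closed form \<open>ell\<close>, which holds at
    every t for the same constant.\<close>
  also have "\<dots> \<longleftrightarrow> (\<exists>c\<^sub>1 c\<^sub>2. (\<forall>t\<in>J'. 1 - z * c\<^sub>1 * exp (\<gamma> t) > 0) \<and>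
      (\<forall>t\<in>J'. q t = ell c\<^sub>1 t * (exp (- \<gamma> t) - z * c\<^sub>1) * (c\<^sub>2 + L c\<^sub>1 t) \<and> p t = ell c\<^sub>1 t))"
    by (metis (no_types, lifting))
  finally show ?thesis
    unfolding yp q_def ell_def .
qed

end
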